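(* Let $n,m\ge0$ be integers and let $\alpha,\beta,\gamma,\delta$ be real numbers such that all the Racah polynomials appearing below are well defined (no denominator vanishes in the defining formulas of $r_k^{\alpha-n-m,\beta-n-m,\gamma-n-m,\delta}$ for $m\le k\le m+n-1$ and of $r_k^{-\alpha,-\beta,-\gamma,-\delta}$ for $n\le k\le n+m-1$). With $$R^{\alpha,\beta,\gamma,\delta}_{n,m,x}=\frac{\det\left(r^{\alpha,\beta,\gamma,\delta}_{m+j-1}\bigl(\lambda^{\gamma,\delta}(x+i-1)\bigr)\right)_{i,j=1}^n}{\prod_{l=1}^{n-1}(2x+\gamma+\delta+1+l)_l},\qquad\lambda^{\gamma,\delta}(x)=x(x+\gamma+\delta+1),$$ we have $$R^{\alpha-n-m,\beta-n-m,\gamma-n-m,\delta}_{n,m,x}=R^{-\alpha,-\beta,-\gamma,-\delta}_{m,n,-x}.$$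
   Context: The (normalized) Racah polynomials are $$r_k^{\alpha,\beta,\gamma,\delta}(x)=\sum_{j=0}^k\frac{(\alpha+1+j)_{k-j}(\beta+\delta+1+j)_{k-j}(\gamma+1+j)_{k-j}}{(-1)^j(k-j)!\,(k+\alpha+\beta+1+j)_{k-j}}f_j(x),\qquad f_j(x)=\frac{(-1)^j}{j!}\prod_{i=0}^{j-1}\bigl(x-i(\gamma+\delta+1+i)\bigr),$$ where $(u)_l=u(u+1)\cdots(u+l-1)$, $(u)_0=1$; they are well defined when $(k+\alpha+\beta+1+j)_{k-j}\neq0$ for $0\le j\le k$. A $0\times0$ determinant and an empty product equal $1$. The identity is an identity of rational functions of $x$. *)

theory Defs
  imports
    "HOL-Computational_Algebra.Computational_Algebra"
    "Jordan_Normal_Form.Determinant"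
begin

definition racah_f :: "real \<Rightarrow> real \<Rightarrow> nat \<Rightarrow> real poly" where
  "racah_f \<gamma> \<delta> j =
     Polynomial.smult ((-1) ^ j / fact j) (\<Prod>i<j. [:- (real i * (\<gamma> + \<delta> + 1 + real i)), 1:])"

definition racah_poly :: "real \<Rightarrow> real \<Rightarrow> real \<Rightarrow> real \<Rightarrow> nat \<Rightarrow> real poly" where
  "racah_poly \<alpha> \<beta> \<gamma> \<delta> k =
     (\<Sum>j\<le>k. Polynomial.smult
        ((pochhammer (\<alpha> + 1 + real j) (k - j)
            * pochhammer (\<beta> + \<delta> + 1 + real j) (k - j)
            * pochhammer (\<gamma> + 1 + real j) (k - j))
          / ((-1) ^ j * fact (k - j) * pochhammer (real k + \<alpha> + \<beta> + 1 + real j) (k - j)))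
        (racah_f \<gamma> \<delta> j))"

definition racah_well_defined :: "real \<Rightarrow> real \<Rightarrow> nat \<Rightarrow> bool" where
  "racah_well_defined \<alpha> \<beta> k \<longleftrightarrow>
     (\<forall>j\<le>k. pochhammer (real k + \<alpha> + \<beta> + 1 + real j) (k - j) \<noteq> 0)"

definition racah_lambda :: "real \<Rightarrow> real \<Rightarrow> real poly \<Rightarrow> real poly" where
  "racah_lambda \<gamma> \<delta> p = p * (p + [:\<gamma> + \<delta> + 1:])"

text \<open>The last argument \<open>p\<close> is the polynomial substituted for the indeterminate \<open>x\<close>, so that
  \<open>p = [:0, 1:]\<close> gives the value at \<open>x\<close> and \<open>p = - [:0, 1:]\<close> the value at \<open>-x\<close>. In both cases
  the denominator is a nonzero polynomial. Matrix indices start at \<open>0\<close>.\<close>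

definition racah_R ::
    "real \<Rightarrow> real \<Rightarrow> real \<Rightarrow> real \<Rightarrow> nat \<Rightarrow> nat \<Rightarrow> real poly \<Rightarrow> real poly fract" where
  "racah_R \<alpha> \<beta> \<gamma> \<delta> n m p =
     Fract
       (det (mat n n (\<lambda>(i, j).
          pcompose (racah_poly \<alpha> \<beta> \<gamma> \<delta> (m + j)) (racah_lambda \<gamma> \<delta> (p + of_nat i)))))
       (\<Prod>l = 1..<n. pochhammer (2 * p + [:\<gamma> + \<delta> + 1 + real l:]) l)"

end

theory Submission
  imports Defs
begin

text \<open>Put \<open>d = n + m - 1\<close>, \<open>A = \<alpha> - n - m\<close> (similarly \<open>B\<close>, \<open>G\<close>) and \<open>c = G + \<delta> + 1\<close>.
  The two families \<open>r\<^sub>k\<close> (parameters \<open>A, B, G, \<delta>\<close>) and \<open>r'\<^sub>k\<close> (parameters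
  \<open>-\<alpha>, -\<beta>, -\<gamma>, -\<delta>\<close>) are dual to each other through the kernel
  \<open>(y - t)\<^sub>d (y + t + c)\<^sub>d = d! \<Sum>\<^sub>k (-1)\<^sup>k r\<^sub>k(\<lambda>(t)) r'\<^bsub>d-k\<^esub>(\<lambda>'(-y))\<close>: the coefficient arrays
  of the two families are inverse to each other, and expanding the left-hand side in the \<open>f\<^sub>l\<close> is
  the Pfaff-Saalschuetz sum. At \<open>y = x - s\<close>, \<open>t = x + i\<close> the kernel vanishes for \<open>s + i < d\<close>.
  The matrix \<open>(r\<^sub>k(\<lambda>(x + i)))\<close> of size \<open>n + m\<close>, whose determinant is of Vandermonde type, is
  therefore made block triangular by the matrix of values of \<open>r'\<close>. As in Jacobi's theorem on
  complementary minors, this relates an \<open>n \<times> n\<close> minor in \<open>r\<close> to an \<open>m \<times> m\<close> minor in \<open>r'\<close>.\<close>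

section \<open>The kernel identity\<close>

text \<open>The terminating Pfaff-Saalschuetz sum, cleared of denominators so that it makes sense in
  any commutative ring. Induction on \<open>d\<close> works because the new factor splits, for each
  \<open>l\<close>, into a part that stays at index \<open>l\<close> and a part that moves to
  \<open>Suc l\<close>.\<close>

lemma pochhammer_saalschuetz:
  fixes y t c :: "'a::comm_ring_1"
  shows "pochhammer (y - t) d * pochhammer (y + t + c) d
       = (\<Sum>l\<le>d. of_nat (d choose l) * (pochhammer (- t) l * pochhammer (t + c) l)
            * (pochhammer y (d - l) * pochhammer (y + c + of_nat l) (d - l)))"
proof (induction d)
  case 0
  show ?case by simp
next
  case (Suc d)
  define \<phi> where "\<phi> l = pochhammer (- t) l * pochhammer (t + c) l" for l
  define g where "g l = pochhammer y (d - l) * pochhammer (y + c + of_nat l) (d - l)" for l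
  \<comment> \<open>\<open>A l\<close> is the part that stays, \<open>T l\<close> the summand wanted
    for \<open>Suc d\<close>. Apart from the binomial they differ in one factor:
    \<open>y + c + of_nat d + of_nat l\<close> in \<open>A\<close>, \<open>y + c + of_nat d\<close>
    in \<open>T\<close>.\<close>
  define A where "A l = of_nat (d choose l) * \<phi> l
    * (pochhammer y (Suc d - l) * pochhammer (y + c + of_nat l) (d - l) * (y + c + of_nat d + of_nat l))" for l
  define T where "T l = of_nat (Suc d choose l) * \<phi> l
    * (pochhammer y (Suc d - l) * pochhammer (y + c + of_nat l) (Suc d - l))" for l
  have step: "of_nat (d choose l) * \<phi> l * g l * ((y - t + of_nat d) * (y + t + c + of_nat d))
      = A l + of_nat (d choose l) * \<phi> (Suc l) * g l" if l: "l \<le> d" for l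
  proof -
    obtain e where d: "d = l + e" using le_Suc_ex[OF l] by blast
    have "pochhammer y (Suc d - l) = pochhammer y (d - l) * (y + of_nat e)"
      by (simp add: d Suc_diff_le pochhammer_Suc)
    then have A: "A l = of_nat (d choose l) * \<phi> l * g l
        * ((y + of_nat e) * (y + c + of_nat d + of_nat l))"
      unfolding A_def g_def by (simp only: mult_ac)
    have \<phi>: "\<phi> (Suc l) = \<phi> l * ((- t + of_nat l) * (t + c + of_nat l))"
      unfolding \<phi>_def pochhammer_Suc by (simp only: mult_ac)
    have key: "(y - t + of_nat d) * (y + t + c + of_nat d)
        = (y + of_nat e) * (y + c + of_nat d + of_nat l) + (- t + of_nat l) * (t + c + of_nat l)"
      by (simp add: d algebra_simps)
    show ?thesis unfolding key A \<phi> by (simp only: distrib_left mult_ac)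
  qed
  have T0: "T 0 = A 0"
    by (simp add: T_def A_def \<phi>_def pochhammer_Suc algebra_simps)
  have TS: "T (Suc i) = A (Suc i) + of_nat (d choose i) * \<phi> (Suc i) * g i" if i: "i \<le> d" for i
  proof (cases "i = d")
    case True
    then show ?thesis by (simp add: T_def A_def g_def binomial_eq_0)
  next
    case False
    then obtain e where d: "d = Suc (i + e)" using less_imp_Suc_add[of i d] i by auto
    define X where "X = pochhammer (1 + (c + (y + of_nat i))) e"
    define B1 where "B1 = (of_nat (d choose i) :: 'a)"
    define B2 where "B2 = (of_nat (d choose Suc i) :: 'a)"
    \<comment> \<open>The defect between the two sides of \<open>key\<close> below is
      \<open>(d - i) * B1 - Suc i * B2\<close>, which absorption makes zero.\<close>
    have "(d - i) * (d choose i) = Suc i * (d choose Suc i)"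
      by (metis binomial_absorption binomial_absorb_comp)
    then have "of_nat ((d - i) * (d choose i)) = (of_nat (Suc i * (d choose Suc i)) :: 'a)"
      by simp
    then have bin: "(1 + of_nat e) * B1 = (1 + of_nat i) * B2"
      by (simp add: d B1_def B2_def algebra_simps del: binomial_Suc_Suc)
    have g: "g i = pochhammer y (Suc e) * ((y + c + of_nat i) * X)"
      using pochhammer_rec[of "y + c + of_nat i" e] by (simp add: g_def d X_def add_ac)
    have A: "A (Suc i) = B2 * \<phi> (Suc i)
        * (pochhammer y (Suc e) * X * (y + c + of_nat d + of_nat (Suc i)))"
      by (simp add: A_def d B2_def X_def add_ac mult_ac del: binomial_Suc_Suc)
    have T: "T (Suc i) = (B1 + B2) * \<phi> (Suc i) * (pochhammer y (Suc e) * (X * (y + c + of_nat d)))"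
    proof -
      have "pochhammer (y + c + of_nat (Suc i)) (Suc e) = X * (y + c + of_nat d)"
        by (simp add: X_def d pochhammer_Suc algebra_simps)
      then show ?thesis
        unfolding T_def B1_def B2_def using d by (simp del: of_nat_Suc)
    qed
    have key: "(B1 + B2) * (y + c + of_nat d)
        = B2 * (y + c + of_nat d + of_nat (Suc i)) + B1 * (y + c + of_nat i)"
      using bin by (simp add: d algebra_simps)
    have "T (Suc i) = \<phi> (Suc i) * pochhammer y (Suc e) * X * ((B1 + B2) * (y + c + of_nat d))"
      unfolding T by (simp only: mult_ac)
    also have "\<dots> = A (Suc i) + B1 * \<phi> (Suc i) * g i"
      unfolding A g key by (simp only: algebra_simps)
    finally show ?thesis unfolding B1_def .
  qed
  have "pochhammer (y - t) (Suc d) * pochhammer (y + t + c) (Suc d)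
      = (pochhammer (y - t) d * pochhammer (y + t + c) d) * ((y - t + of_nat d) * (y + t + c + of_nat d))"
    by (simp add: pochhammer_Suc mult_ac)
  also have "\<dots> = (\<Sum>l\<le>d. of_nat (d choose l) * \<phi> l * g l * ((y - t + of_nat d) * (y + t + c + of_nat d)))"
    unfolding Suc.IH by (simp add: sum_distrib_right \<phi>_def g_def)
  also have "\<dots> = (\<Sum>l\<le>d. A l) + (\<Sum>l\<le>d. of_nat (d choose l) * \<phi> (Suc l) * g l)"
    by (simp add: step sum.distrib)
  also have "(\<Sum>l\<le>d. A l) = (\<Sum>l\<le>Suc d. A l)"
    by (simp add: A_def binomial_eq_0)
  also have "\<dots> = A 0 + (\<Sum>i\<le>d. A (Suc i))"
    by (rule sum.atMost_Suc_shift)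
  also have "A 0 + (\<Sum>i\<le>d. A (Suc i)) + (\<Sum>l\<le>d. of_nat (d choose l) * \<phi> (Suc l) * g l)
      = T 0 + (\<Sum>i\<le>d. T (Suc i))"
    by (simp add: T0 TS sum.distrib)
  also have "\<dots> = (\<Sum>l\<le>Suc d. T l)"
    by (rule sum.atMost_Suc_shift[symmetric])
  finally show ?case by (simp add: T_def \<phi>_def)
qed

text \<open>The sum telescopes. Since \<open>b + 2i\<close> cancels from the \<open>i\<close>-th term, \<open>b = 0\<close> and \<open>b + 2M = 0\<close>
  are allowed; this is why the well-definedness assumptions of the theorem suffice.\<close>

lemma sum_inverse_pair_eq_0:
  fixes b :: "'a::field_char_0"
  assumes "M \<ge> 1" and nz: "\<And>q. 1 \<le> q \<Longrightarrow> q < 2 * M \<Longrightarrow> b + of_nat q \<noteq> 0"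
  shows "(\<Sum>i\<le>M. (-1) ^ i / (fact i * fact (M - i) * pochhammer (b + of_nat i) i
            * pochhammer (b + 2 * of_nat i + 1) (M - i))) = 0"
proof -
  \<comment> \<open>The \<open>i\<close>-th term will be \<open>S i - S (Suc i)\<close>. The zero
    values stand for 1/(-1)! at both ends, where truncated subtraction would yield
    \<open>fact 0\<close> instead.\<close>
  define S where "S i = (if i = 0 \<or> M < i then 0 else
     (-1) ^ i / (fact (i - 1) * fact (M - i) * of_nat M * pochhammer (b + of_nat i) M))" for i
  have "(-1) ^ i / (fact i * fact (M - i) * pochhammer (b + of_nat i) i
            * pochhammer (b + 2 * of_nat i + 1) (M - i)) = S i - S (Suc i)" if "i \<le> M" for i
  proof -
    \<comment> \<open>At either end one of the two \<open>S\<close> values is zero and the other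
      matches the term directly, with nothing cancelled. Only interior indices use that the factors,
      \<open>b + 2 * i\<close> among them, are nonzero.\<close>
    consider "i = 0" | "i = M" "i \<noteq> 0" | a e where "i = Suc a" "M = Suc (Suc (a + e))"
      using \<open>i \<le> M\<close> by (metis add_Suc less_iff_Suc_add nat_less_le not0_implies_Suc)
    then show ?thesis
    proof cases
      case 1
      then show ?thesis using \<open>M \<ge> 1\<close>
        by (cases M) (simp_all add: S_def add.commute)
    next
      case 2
      then show ?thesis
        by (cases M) (simp_all add: S_def mult_ac)
    next
      case 3
      define X where "X = pochhammer (b + of_nat i + 1) a"
      define Y where "Y = pochhammer (b + 2 * of_nat i + 1) e"
      define w where "w = b + 2 * of_nat i"
      define v where "v = b + of_nat i"
      define z where "z = b + of_nat i + of_nat M"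
      have nz1: "pochhammer (b + of_nat p) k \<noteq> 0" if "1 \<le> p" "p + k \<le> 2 * M" for p k
      proof
        assume "pochhammer (b + of_nat p) k = 0"
        then obtain q where "q < k" "b + of_nat p = - of_nat q"
          by (auto simp: pochhammer_eq_0_iff)
        then show False using nz[of "p + q"] that by (simp add: add.assoc[symmetric])
      qed
      have "X \<noteq> 0" using nz1[of "i + 1" a] 3 by (simp add: X_def add_ac)
      moreover have "Y \<noteq> 0" using nz1[of "2 * i + 1" e] 3 by (simp add: Y_def add_ac)
      moreover have "w \<noteq> 0" using nz[of "2 * i"] 3 by (simp add: w_def add_ac)
      moreover have "v \<noteq> 0" using nz[of i] 3 by (simp add: v_def)
      moreover have "z \<noteq> 0" using nz[of "i + M"] 3 by (simp add: z_def add_ac)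
      moreover have p1: "pochhammer (b + of_nat i) i = v * X"
        using pochhammer_rec[of "b + of_nat i" a] by (simp add: 3 X_def v_def)
      moreover have p2: "pochhammer (b + 2 * of_nat i + 1) (M - i) = Y * z"
        using pochhammer_Suc[of "b + 2 * of_nat i + 1" e] by (simp add: 3 Y_def z_def add_ac)
      moreover have U: "pochhammer (b + of_nat i + 1) (Suc (a + e)) = X * w * Y"
        using pochhammer_product[of a "Suc (a + e)" "b + of_nat i + 1"]
          pochhammer_rec[of "b + of_nat i + 1 + of_nat a" e]
        by (simp add: 3 X_def w_def Y_def add_ac)
      moreover have "pochhammer (b + of_nat i) M = v * (X * w * Y)"
        using pochhammer_rec[of "b + of_nat i" "Suc (a + e)"] U by (simp add: 3 v_def)
      moreover have "pochhammer (b + of_nat (Suc i)) M = X * w * Y * z"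
        using pochhammer_Suc[of "b + of_nat i + 1" "Suc (a + e)"] U
        by (simp add: 3 z_def add_ac)
      moreover have "fact i = (of_nat i * fact a :: 'a)" by (simp add: 3)
      moreover have "fact (M - i) = (of_nat (Suc e) * fact e :: 'a)" by (simp add: 3)
      moreover have "M - Suc i = e" "i - 1 = a" "i \<noteq> 0" "\<not> M < i" "\<not> M < Suc i" using 3 by auto
      \<comment> \<open>The relation that merges the two fractions: over a common denominator they
        contribute \<open>i * z\<close> and \<open>(M - i) * v\<close>, and the sum cancels against
        \<open>M * w\<close>.\<close>
      moreover have key: "of_nat M * w = of_nat i * z + of_nat (Suc e) * v"
        by (simp add: 3 w_def z_def v_def algebra_simps)
      moreover have "of_nat M \<noteq> (0::'a)" "of_nat i \<noteq> (0::'a)" "of_nat (Suc e) \<noteq> (0::'a)"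
        using 3 by (simp_all del: of_nat_Suc)
      moreover have "1 / (I * fa * (E * fe) * (v * X) * (Y * z)) =
          1 / (fa * (E * fe) * m * (v * (X * w * Y))) + 1 / (I * fa * fe * m * (X * w * Y * z))"
        if "m * w = I * z + E * v" "m \<noteq> 0" "I \<noteq> 0" "E \<noteq> 0" "fa \<noteq> 0" "fe \<noteq> 0"
          "X \<noteq> 0" "Y \<noteq> 0" "w \<noteq> 0" "v \<noteq> 0" "z \<noteq> 0" for I fa E fe m :: 'a
      proof -
        have "1 / (fa * (E * fe) * m * (v * (X * w * Y))) + 1 / (I * fa * fe * m * (X * w * Y * z))
            = (I * z + E * v) / (m * w * (I * fa * (E * fe) * (v * X) * (Y * z)))"
          using that(2-) by (simp add: divide_simps)
        then show ?thesis using that(2-) by (simp add: that(1)[symmetric])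
      qed
      from this[OF key] calculation have
        "1 / (fact i * fact (M - i) * pochhammer (b + of_nat i) i * pochhammer (b + 2 * of_nat i + 1) (M - i))
         = 1 / (fact a * fact (M - i) * of_nat M * pochhammer (b + of_nat i) M)
           + 1 / (fact i * fact e * of_nat M * pochhammer (b + of_nat (Suc i)) M)"
        by (simp del: of_nat_Suc fact_Suc pochhammer_Suc)
      from arg_cong[OF this, of "\<lambda>u. (-1) ^ i * u"] show ?thesis
        using \<open>M - Suc i = e\<close> \<open>i - 1 = a\<close> \<open>i \<noteq> 0\<close> \<open>\<not> M < i\<close> \<open>\<not> M < Suc i\<close>
        by (simp add: S_def distrib_left del: of_nat_Suc)
    qed
  qed
  then have "(\<Sum>i\<le>M. (-1) ^ i / (fact i * fact (M - i) * pochhammer (b + of_nat i) i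
            * pochhammer (b + 2 * of_nat i + 1) (M - i))) = (\<Sum>i\<le>M. S i - S (Suc i))"
    by (intro sum.cong) auto
  also have "\<dots> = S 0 - S (Suc M)" by (rule sum_telescope)
  finally show ?thesis by (simp add: S_def)
qed

section \<open>Coefficient arrays of the two dual families\<close>

lemma poly_racah_f:
  "poly (racah_f \<gamma> \<delta> j) (t * (t + \<gamma> + \<delta> + 1))
     = pochhammer (- t) j * pochhammer (t + \<gamma> + \<delta> + 1) j / fact j"
proof -
  \<comment> \<open>On the quadratic lattice each factor splits: with
    \<open>s = \<gamma> + \<delta> + 1\<close>,
    \<open>t * (t + s) - i * (s + i) = (t - i) * (t + s + i)\<close>.\<close>
  have "(\<Prod>i<j. t * (t + \<gamma> + \<delta> + 1) - real i * (\<gamma> + \<delta> + 1 + real i))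
      = (-1) ^ j * (pochhammer (- t) j * pochhammer (t + \<gamma> + \<delta> + 1) j)"
    by (induction j) (simp_all add: pochhammer_Suc, simp add: algebra_simps)
  then show ?thesis
    by (simp add: racah_f_def poly_prod mult_ac flip: power_mult_distrib)
qed

text \<open>For \<open>k < j\<close> truncated subtraction gives the value \<open>(-1) ^ j\<close>
  instead of 0, so sums over the full index range guard the array explicitly.\<close>

definition racah_coeff :: "real \<Rightarrow> real \<Rightarrow> real \<Rightarrow> real \<Rightarrow> nat \<Rightarrow> nat \<Rightarrow> real" where
  "racah_coeff \<alpha> \<beta> \<gamma> \<delta> k j =
     pochhammer (\<alpha> + 1 + real j) (k - j) * pochhammer (\<beta> + \<delta> + 1 + real j) (k - j)
       * pochhammer (\<gamma> + 1 + real j) (k - j)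
       / ((-1) ^ j * fact (k - j) * pochhammer (real k + \<alpha> + \<beta> + 1 + real j) (k - j))"

lemma poly_racah_poly:
  "poly (racah_poly \<alpha> \<beta> \<gamma> \<delta> k) (t * (t + \<gamma> + \<delta> + 1))
    = (\<Sum>j\<le>k. racah_coeff \<alpha> \<beta> \<gamma> \<delta> k j
         * (pochhammer (- t) j * pochhammer (t + \<gamma> + \<delta> + 1) j / fact j))"
  by (simp add: racah_poly_def poly_sum poly_racah_f racah_coeff_def)

text \<open>Reading the product backwards negates every factor. Linking \<open>u\<close> and
  \<open>v\<close> by an equation leaves only linear arithmetic to check at each use.\<close>

lemma pochhammer_reflect:
  fixes u v :: "'a::comm_ring_1"
  assumes "u + v + of_nat n = 1"
  shows "pochhammer u n = (-1) ^ n * pochhammer v n"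
proof -
  have v: "v = - u - of_nat n + 1" using assms by (simp add: algebra_simps)
  show ?thesis using pochhammer_minus[of "- u" n] by (simp add: v)
qed

text \<open>All four Pochhammer symbols reflect, three above and one below the bar, so their signs
  cancel. The numerator symbols now start where those of \<open>racah_coeff A B G D k j\<close>
  end.\<close>

lemma racah_coeff_dual:
  assumes "k \<le> l" "l \<le> d"
  shows "racah_coeff (- A - real d - 1) (- B - real d - 1) (- G - real d - 1) (- D) (d - k) (d - l)
    = pochhammer (A + 1 + real k) (l - k) * pochhammer (B + D + 1 + real k) (l - k)
      * pochhammer (G + 1 + real k) (l - k)
      / ((-1) ^ (d - l) * fact (l - k) * pochhammer (A + B + 2 * real k + 2) (l - k))"
proof -
  define M where "M = l - k"
  have M: "real M = real l - real k" "d - k - (d - l) = M" "l - k = M"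
    and r: "real (d - k) = real d - real k" "real (d - l) = real d - real l"
    using assms by (simp_all add: M_def of_nat_diff)
  have 1: "pochhammer (- A - real d - 1 + 1 + real (d - l)) M = (-1) ^ M * pochhammer (A + 1 + real k) M"
    by (rule pochhammer_reflect) (simp add: M r)
  have 2: "pochhammer (- B - real d - 1 + - D + 1 + real (d - l)) M
      = (-1) ^ M * pochhammer (B + D + 1 + real k) M"
    by (rule pochhammer_reflect) (simp add: M r)
  have 3: "pochhammer (- G - real d - 1 + 1 + real (d - l)) M = (-1) ^ M * pochhammer (G + 1 + real k) M"
    by (rule pochhammer_reflect) (simp add: M r)
  have 4: "pochhammer (real (d - k) + (- A - real d - 1) + (- B - real d - 1) + 1 + real (d - l)) M
      = (-1) ^ M * pochhammer (A + B + 2 * real k + 2) M"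
    by (rule pochhammer_reflect) (simp add: M r)
  show ?thesis
    unfolding racah_coeff_def M 1 2 3 4 by (cases "even M") simp_all
qed

text \<open>The numerators concatenate to symbols running from \<open>j\<close> to \<open>l\<close>,
  independent of \<open>k\<close>. What remains is the alternating sum of
  \<open>sum_inverse_pair_eq_0\<close> with \<open>b = A + B + 1 + 2 * j\<close> and
  \<open>M = l - j\<close>, whose conditions concern \<open>A + B + q\<close> for \<open>q\<close>
  between 2 and \<open>2 * l\<close>.\<close>

lemma racah_coeff_orthogonality:
  assumes nz: "\<And>q. 2 \<le> q \<Longrightarrow> q \<le> 2 * d \<Longrightarrow> A + B + real q \<noteq> 0"
    and "j \<le> d" "l \<le> d"
  shows "(\<Sum>k\<le>d. (-1) ^ k * (if j \<le> k then racah_coeff A B G D k j else 0)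
      * (if k \<le> l then racah_coeff (- A - real d - 1) (- B - real d - 1) (- G - real d - 1) (- D)
            (d - k) (d - l) else 0))
    = (if j = l then (-1) ^ (d - l) else 0)" (is "sum ?h _ = _")
proof (cases "j \<le> l")
  case False
  then have "?h k = 0" for k by auto
  then have "sum ?h {..d} = 0" by (rule sum.neutral[rule_format])
  moreover have "j \<noteq> l" using False by simp
  ultimately show ?thesis by (simp only: if_False)
next
  case True
  define M where "M = l - j"
  have l: "l = j + M" using True by (simp add: M_def)
  define b where "b = A + B + 1 + 2 * real j"
  define p where "p = pochhammer (A + 1 + real j) M * pochhammer (B + D + 1 + real j) M
      * pochhammer (G + 1 + real j) M"
  define w where "w i = (-1) ^ i / (fact i * fact (M - i) * pochhammer (b + real i) i
            * pochhammer (b + 2 * real i + 1) (M - i))" for i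
  have h: "?h (j + i) = (-1) ^ (d - l) * p * w i" if "i \<le> M" for i
  proof -
    have split: "pochhammer (u + 1 + real j) M
        = pochhammer (u + 1 + real j) i * pochhammer (u + 1 + real (j + i)) (M - i)" for u
      using pochhammer_product[OF that, of "u + 1 + real j"] by (simp add: add_ac)
    have b1: "real (j + i) + A + B + 1 + real j = b + real i"
      and b2: "A + B + 2 * real (j + i) + 2 = b + 2 * real i + 1" by (simp_all add: b_def)
    have sgn: "(-1) ^ (j + i) / ((-1) ^ j * (-1) ^ (d - l)) = (-1) ^ (d - l) * (-1::real) ^ i"
      by (cases "even j"; cases "even (d - l)") (simp_all add: power_add)
    have start: "?h (j + i) = (-1) ^ (j + i) * racah_coeff A B G D (j + i) j
        * racah_coeff (- A - real d - 1) (- B - real d - 1) (- G - real d - 1) (- D) (d - (j + i)) (d - l)"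
      using that by (simp add: l)
    have c': "racah_coeff (- A - real d - 1) (- B - real d - 1) (- G - real d - 1) (- D) (d - (j + i)) (d - l)
        = pochhammer (A + 1 + real (j + i)) (M - i) * pochhammer (B + D + 1 + real (j + i)) (M - i)
      * pochhammer (G + 1 + real (j + i)) (M - i)
      / ((-1) ^ (d - l) * fact (M - i) * pochhammer (b + 2 * real i + 1) (M - i))"
      using that assms by (subst racah_coeff_dual) (simp_all only: b2, simp_all add: l)
    have c: "racah_coeff A B G D (j + i) j = pochhammer (A + 1 + real j) i
        * pochhammer (B + D + 1 + real j) i * pochhammer (G + 1 + real j) i
        / ((-1) ^ j * fact i * pochhammer (b + real i) i)"
      unfolding racah_coeff_def b1 by simp
    have "(-1) ^ (j + i) * (pochhammer (A + 1 + real j) i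
        * pochhammer (B + D + 1 + real j) i * pochhammer (G + 1 + real j) i
        / ((-1) ^ j * fact i * pochhammer (b + real i) i))
      * (pochhammer (A + 1 + real (j + i)) (M - i) * pochhammer (B + D + 1 + real (j + i)) (M - i)
      * pochhammer (G + 1 + real (j + i)) (M - i)
      / ((-1) ^ (d - l) * fact (M - i) * pochhammer (b + 2 * real i + 1) (M - i)))
      = (-1) ^ (j + i) / ((-1) ^ j * (-1) ^ (d - l)) * p
        / (fact i * fact (M - i) * pochhammer (b + real i) i * pochhammer (b + 2 * real i + 1) (M - i))"
      unfolding p_def split[of A] split[of "B + D"] split[of G] by (simp add: mult_ac del: of_nat_add)
    also have "\<dots> = (-1) ^ (d - l) * p * w i"
      unfolding sgn w_def by (simp add: mult_ac)
    finally show ?thesis by (intro trans[OF start]) (simp only: c c')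
  qed
  have "sum ?h {..d} = sum ?h {j..j + M}"
    using assms True by (intro sum.mono_neutral_right) (auto simp: l)
  also have "\<dots> = (\<Sum>i\<le>M. ?h (j + i))"
    by (rule sum.reindex_bij_witness[of _ "\<lambda>i. j + i" "\<lambda>k. k - j"]) auto
  also have "\<dots> = (-1) ^ (d - l) * p * (\<Sum>i\<le>M. w i)"
    unfolding sum_distrib_left by (rule sum.cong[OF refl]) (simp only: h atMost_iff)
  also have "\<dots> = (if j = l then (-1) ^ (d - l) else 0)"
  proof (cases "M = 0")
    case True
    then show ?thesis by (simp add: l p_def w_def)
  next
    case False
    have "(\<Sum>i\<le>M. w i) = 0"
      unfolding w_def
    proof (rule sum_inverse_pair_eq_0)
      fix q assume "1 \<le> q" "q < 2 * M"
      then show "b + real q \<noteq> 0"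
        using nz[of "2 * j + 1 + q"] \<open>l \<le> d\<close> by (simp add: l b_def add_ac)
    qed (use False in auto)
    then show ?thesis using False l by simp
  qed
  finally show ?thesis .
qed

text \<open>\<open>y * (y + G + D + real d)\<close> is the lattice of the dual parameters taken at
  \<open>- y\<close>. Summing over \<open>k\<close> first leaves only the diagonal
  \<open>j = l\<close>, and its terms are those of the Saalschuetz sum.\<close>

lemma racah_kernel:
  assumes nz: "\<And>q. 2 \<le> q \<Longrightarrow> q \<le> 2 * d \<Longrightarrow> A + B + real q \<noteq> 0"
  shows "pochhammer (y - t) d * pochhammer (y + t + (G + D + 1)) d
    = fact d * (\<Sum>k\<le>d. (-1) ^ k * poly (racah_poly A B G D k) (t * (t + G + D + 1))
        * poly (racah_poly (- A - real d - 1) (- B - real d - 1) (- G - real d - 1) (- D) (d - k))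
            (y * (y + G + D + real d)))"
proof -
  define u where "u k j = (if j \<le> k then racah_coeff A B G D k j else 0)" for k j
  define v where "v k l = (if k \<le> l then racah_coeff (- A - real d - 1) (- B - real d - 1)
      (- G - real d - 1) (- D) (d - k) (d - l) else 0)" for k l
  define F where "F j = pochhammer (- t) j * pochhammer (t + G + D + 1) j / fact j" for j
  define F' where "F' j = pochhammer y j * pochhammer (- y - G - D - real d) j / fact j" for j
  have r: "poly (racah_poly A B G D k) (t * (t + G + D + 1)) = (\<Sum>j\<le>d. u k j * F j)" if "k \<le> d" for k
    unfolding poly_racah_poly F_def u_def
    using that by (intro sum.mono_neutral_cong_left) auto
  have r': "poly (racah_poly (- A - real d - 1) (- B - real d - 1) (- G - real d - 1) (- D) (d - k))
            (y * (y + G + D + real d)) = (\<Sum>l\<le>d. v k l * F' (d - l))" if "k \<le> d" for k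
  proof -
    define cf where "cf = racah_coeff (- A - real d - 1) (- B - real d - 1) (- G - real d - 1) (- D)"
    have e: "y * (y + G + D + real d) = (- y) * (- y + (- G - real d - 1) + - D + 1)"
      by (simp add: algebra_simps)
    have e': "- y + (- G - real d - 1) + - D + 1 = - y - G - D - real d" by simp
    have "poly (racah_poly (- A - real d - 1) (- B - real d - 1) (- G - real d - 1) (- D) (d - k))
            (y * (y + G + D + real d)) = (\<Sum>j\<le>d - k. cf (d - k) j * F' j)"
      unfolding e poly_racah_poly unfolding e' F'_def cf_def by simp
    also have "\<dots> = (\<Sum>l\<in>{k..d}. cf (d - k) (d - l) * F' (d - l))"
      by (rule sum.reindex_bij_witness[of _ "\<lambda>l. d - l" "\<lambda>j. d - j"]) (use that in auto)
    also have "\<dots> = (\<Sum>l\<le>d. v k l * F' (d - l))"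
      unfolding v_def cf_def by (intro sum.mono_neutral_cong_left) auto
    finally show ?thesis .
  qed
  have orth: "(\<Sum>k\<le>d. (-1) ^ k * u k j * v k l) = (if j = l then (-1) ^ (d - l) else 0)"
    if "j \<le> d" "l \<le> d" for j l
    unfolding u_def v_def by (rule racah_coeff_orthogonality[OF nz that])
  \<comment> \<open>The sign left over by orthogonality is absorbed by reflecting the second symbol
    of \<open>F'\<close>.\<close>
  have F': "(-1) ^ (d - l) * F' (d - l)
      = pochhammer y (d - l) * pochhammer (y + (G + D + 1) + real l) (d - l) / fact (d - l)"
    if "l \<le> d" for l
  proof -
    have "pochhammer (- y - G - D - real d) (d - l)
        = (-1) ^ (d - l) * pochhammer (y + (G + D + 1) + real l) (d - l)"
      by (rule pochhammer_reflect) (use that in \<open>simp add: of_nat_diff\<close>)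
    then show ?thesis by (simp add: F'_def mult_ac flip: power_mult_distrib)
  qed
  have "(\<Sum>k\<le>d. (-1) ^ k * poly (racah_poly A B G D k) (t * (t + G + D + 1))
        * poly (racah_poly (- A - real d - 1) (- B - real d - 1) (- G - real d - 1) (- D) (d - k))
            (y * (y + G + D + real d)))
      = (\<Sum>k\<le>d. \<Sum>j\<le>d. \<Sum>l\<le>d. F j * F' (d - l) * ((-1) ^ k * u k j * v k l))"
    by (intro sum.cong refl) (simp add: r r' sum_distrib_left sum_distrib_right mult_ac)
  also have "\<dots> = (\<Sum>j\<le>d. \<Sum>l\<le>d. \<Sum>k\<le>d. F j * F' (d - l) * ((-1) ^ k * u k j * v k l))"
    by (subst sum.swap) (intro sum.cong refl sum.swap)
  also have "\<dots> = (\<Sum>j\<le>d. \<Sum>l\<le>d. F j * F' (d - l) * (if j = l then (-1) ^ (d - l) else 0))"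
    by (intro sum.cong refl) (simp add: orth flip: sum_distrib_left)
  also have "\<dots> = (\<Sum>j\<le>d. F j * ((-1) ^ (d - j) * F' (d - j)))"
    by (intro sum.cong refl) (simp add: if_distrib[of "\<lambda>z. _ * z"] sum.delta mult_ac cong: if_cong)
  finally have "fact d * (\<Sum>k\<le>d. (-1) ^ k * poly (racah_poly A B G D k) (t * (t + G + D + 1))
        * poly (racah_poly (- A - real d - 1) (- B - real d - 1) (- G - real d - 1) (- D) (d - k))
            (y * (y + G + D + real d))) = (\<Sum>j\<le>d. fact d * (F j * ((-1) ^ (d - j) * F' (d - j))))"
    by (simp add: sum_distrib_left)
  also have "\<dots> = (\<Sum>l\<le>d. real (d choose l) * (pochhammer (- t) l * pochhammer (t + (G + D + 1)) l)
            * (pochhammer y (d - l) * pochhammer (y + (G + D + 1) + real l) (d - l)))"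
    by (intro sum.cong refl) (simp add: F' F_def binomial_fact add.assoc)
  finally show ?thesis unfolding pochhammer_saalschuetz by simp
qed

section \<open>Determinants\<close>

text \<open>The reversal permutation acts once on the rows and, through the transpose, once on the
  columns, so its sign enters squared.\<close>

lemma det_reverse:
  fixes f :: "nat \<Rightarrow> nat \<Rightarrow> 'a::comm_ring_1"
  shows "det (mat n n (\<lambda>(i, j). f (n - 1 - i) (n - 1 - j))) = det (mat n n (\<lambda>(i, j). f i j))"
proof -
  define p where "p i = (if i < n then n - 1 - i else i)" for i
  have p: "p permutes {0..<n}"
    by (rule bij_imp_permutes[OF bij_betw_byWitness[where f' = p]]) (auto simp: p_def)
  define M where "M = mat n n (\<lambda>(i, j). f i j)"
  define M1 where "M1 = mat n n (\<lambda>(i, j). M $$ (p i, j))"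
  have "det (mat n n (\<lambda>(i, j). f (n - 1 - i) (n - 1 - j)))
      = det (transpose_mat (mat n n (\<lambda>(i, j). f (n - 1 - i) (n - 1 - j))))"
    by (rule det_transpose[symmetric]) auto
  also have "transpose_mat (mat n n (\<lambda>(i, j). f (n - 1 - i) (n - 1 - j)))
      = mat n n (\<lambda>(i, j). transpose_mat M1 $$ (p i, j))"
    by (rule eq_matI) (auto simp: M1_def M_def p_def)
  also have "det \<dots> = signof p * det (transpose_mat M1)"
    by (rule det_permute_rows[OF _ p]) (simp add: M1_def)
  also have "det (transpose_mat M1) = det M1"
    by (rule det_transpose[of _ n]) (simp add: M1_def)
  also have "det M1 = signof p * det M"
    unfolding M1_def by (rule det_permute_rows[OF _ p]) (simp add: M_def)
  also have "signof p * (signof p * det M) = det M"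
    by (simp add: sign_def)
  finally show ?thesis unfolding M_def .
qed

lemma det_mat_lower_left_zero:
  fixes f :: "nat \<Rightarrow> nat \<Rightarrow> 'a::idom"
  assumes "\<And>i j. n \<le> i \<Longrightarrow> i < n + m \<Longrightarrow> j < n \<Longrightarrow> f i j = 0"
  shows "det (mat (n + m) (n + m) (\<lambda>(i, j). f i j))
    = det (mat n n (\<lambda>(i, j). f i j)) * det (mat m m (\<lambda>(i, j). f (n + i) (n + j)))"
proof -
  have "mat (n + m) (n + m) (\<lambda>(i, j). f i j)
    = four_block_mat (mat n n (\<lambda>(i, j). f i j)) (mat n m (\<lambda>(i, j). f i (n + j)))
        (0\<^sub>m m n) (mat m m (\<lambda>(i, j). f (n + i) (n + j)))"
    by (rule eq_matI) (use assms in \<open>auto simp: not_less\<close>)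
  then show ?thesis
    by (simp add: det_four_block_mat_lower_left_zero[of _ n _ m])
qed

lemma det_mat_upper_right_zero:
  fixes f :: "nat \<Rightarrow> nat \<Rightarrow> 'a::idom"
  assumes "\<And>i j. i < n \<Longrightarrow> n \<le> j \<Longrightarrow> j < n + m \<Longrightarrow> f i j = 0"
  shows "det (mat (n + m) (n + m) (\<lambda>(i, j). f i j))
    = det (mat n n (\<lambda>(i, j). f i j)) * det (mat m m (\<lambda>(i, j). f (n + i) (n + j)))"
proof -
  have "mat (n + m) (n + m) (\<lambda>(i, j). f i j)
    = four_block_mat (mat n n (\<lambda>(i, j). f i j)) (0\<^sub>m n m)
        (mat m n (\<lambda>(i, j). f (n + i) j)) (mat m m (\<lambda>(i, j). f (n + i) (n + j)))"
    by (rule eq_matI) (use assms in \<open>auto simp: not_less\<close>)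
  then show ?thesis
    by (simp add: det_four_block_mat_upper_right_zero[of _ n _ m])
qed

lemma det_scale_cols:
  fixes f :: "nat \<Rightarrow> nat \<Rightarrow> 'a::comm_ring_1"
  shows "det (mat n n (\<lambda>(i, j). b j * f i j)) = (\<Prod>j<n. b j) * det (mat n n (\<lambda>(i, j). f i j))"
proof -
  have "(\<Prod>i = 0..<n. mat n n (\<lambda>(i, j). b j * f i j) $$ (i, p i))
      = (\<Prod>j<n. b j) * (\<Prod>i = 0..<n. mat n n (\<lambda>(i, j). f i j) $$ (i, p i))"
    if p: "p permutes {0..<n}" for p
  proof -
    have "p i < n" if "i < n" for i using permutes_in_image[OF p, of i] that by simp
    then have "(\<Prod>i = 0..<n. mat n n (\<lambda>(i, j). b j * f i j) $$ (i, p i))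
      = (\<Prod>i = 0..<n. b (p i)) * (\<Prod>i = 0..<n. mat n n (\<lambda>(i, j). f i j) $$ (i, p i))"
      by (simp flip: prod.distrib)
    also have "(\<Prod>i = 0..<n. b (p i)) = (\<Prod>j<n. b j)"
      using prod.permute[OF p, of b] by (simp add: atLeast0LessThan o_def)
    finally show ?thesis .
  qed
  then have "signof p * (\<Prod>i = 0..<n. mat n n (\<lambda>(i, j). b j * f i j) $$ (i, p i))
      = (\<Prod>j<n. b j) * (signof p * (\<Prod>i = 0..<n. mat n n (\<lambda>(i, j). f i j) $$ (i, p i)))"
    if "p permutes {0..<n}" for p
    using that by (simp only: mult.left_commute)
  then show ?thesis
    unfolding det_def'[OF mat_carrier] sum_distrib_left by (intro sum.cong refl) blast
qed

section \<open>Vandermonde-type determinants\<close>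

lemma det_poly_eval_powers:
  fixes p :: "nat \<Rightarrow> 'a::idom poly"
  assumes "\<And>k. k < n \<Longrightarrow> degree (p k) \<le> k"
  shows "det (mat n n (\<lambda>(k, i). poly (p k) (z i)))
    = (\<Prod>k<n. coeff (p k) k) * det (mat n n (\<lambda>(j, i). z i ^ j))"
proof -
  \<comment> \<open>The degree bound makes the coefficient matrix \<open>C\<close> lower triangular,
    and the evaluation matrix is \<open>C\<close> times the Vandermonde matrix
    \<open>V\<close>.\<close>
  define C where "C = mat n n (\<lambda>(k, j). coeff (p k) j)"
  define V where "V = mat n n (\<lambda>(j, i). z i ^ j)"
  have "poly (p k) (z i) = (\<Sum>j = 0..<n. coeff (p k) j * z i ^ j)" if "k < n" for k i
    unfolding poly_altdef using assms[OF that] that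
    by (intro sum.mono_neutral_left) (auto simp: coeff_eq_0)
  then have "mat n n (\<lambda>(k, i). poly (p k) (z i)) = C * V"
    by (intro eq_matI) (auto simp: C_def V_def scalar_prod_def)
  then have "det (mat n n (\<lambda>(k, i). poly (p k) (z i))) = det C * det V"
    by (simp add: det_mult[of _ n] C_def V_def)
  also have "det C = (\<Prod>k<n. coeff (p k) k)"
  proof -
    have "det C = prod_list (diag_mat C)"
    proof (rule det_lower_triangular[of n])
      fix i j assume "i < j" "j < n"
      then show "C $$ (i, j) = 0" using assms[of i] by (simp add: C_def coeff_eq_0)
    qed (simp add: C_def)
    then show ?thesis by (simp add: prod_list_diag_prod C_def atLeast0LessThan)
  qed
  finally show ?thesis by (simp add: V_def)
qed

text \<open>The Vandermonde determinant comes from \<open>det_poly_eval_powers\<close> itself,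
  applied to the monic Newton polynomials \<open>N k\<close>: these vanish at \<open>z i\<close> for
  \<open>i < k\<close>, so their evaluation matrix is triangular.\<close>

lemma det_poly_eval:
  fixes p :: "nat \<Rightarrow> 'a::idom poly"
  assumes "\<And>k. k < n \<Longrightarrow> degree (p k) \<le> k"
  shows "det (mat n n (\<lambda>(k, i). poly (p k) (z i)))
    = (\<Prod>k<n. coeff (p k) k) * (\<Prod>k<n. \<Prod>i<k. z k - z i)"
proof -
  define N where "N k = (\<Prod>i<k. [:- z i, 1:])" for k
  have deg: "degree (N k) = k" for k
    unfolding N_def by (subst degree_prod_eq_sum_degree) auto
  have lc: "coeff (N k) k = 1" for k
    using lead_coeff_prod[of "\<lambda>i. [:- z i, 1:]" "{..<k}"] deg[of k] by (simp add: N_def)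
  define U where "U = mat n n (\<lambda>(k, i). poly (N k) (z i))"
  have "det U = prod_list (diag_mat U)"
  proof (rule det_upper_triangular[where n = n])
    show "upper_triangular U"
      unfolding upper_triangular_def by (auto simp: U_def N_def poly_prod)
  qed (simp add: U_def)
  also have "\<dots> = (\<Prod>k<n. \<Prod>i<k. z k - z i)"
    by (simp add: prod_list_diag_prod U_def N_def poly_prod atLeast0LessThan)
  finally have "det (mat n n (\<lambda>(j, i). z i ^ j)) = (\<Prod>k<n. \<Prod>i<k. z k - z i)"
    using det_poly_eval_powers[of n N z] by (simp add: deg lc U_def)
  then show ?thesis using det_poly_eval_powers[of n p z] assms by simp
qed

text \<open>Only the summand \<open>j = k\<close> reaches degree \<open>k\<close>, and its two signs
  cancel. As the leading coefficient is free of parameters, the full determinant depends on them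
  only through \<gamma> + \<delta>.\<close>

lemma degree_racah_poly: "degree (racah_poly \<alpha> \<beta> \<gamma> \<delta> k) \<le> k"
  and coeff_racah_poly: "coeff (racah_poly \<alpha> \<beta> \<gamma> \<delta> k) k = 1 / fact k"
proof -
  define P where "P j = (\<Prod>i<j. [:- (real i * (\<gamma> + \<delta> + 1 + real i)), 1:])" for j
  have degP: "degree (P j) = j" for j
    unfolding P_def by (subst degree_prod_eq_sum_degree) auto
  have lc: "coeff (P k) k = 1"
    using lead_coeff_prod[of "\<lambda>i. [:- (real i * (\<gamma> + \<delta> + 1 + real i)), 1:]" "{..<k}"] degP[of k]
    by (simp add: P_def)
  have f: "racah_f \<gamma> \<delta> j = Polynomial.smult ((-1) ^ j / fact j) (P j)" for j
    by (simp add: racah_f_def P_def)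
  have deg: "degree (racah_f \<gamma> \<delta> j) \<le> j" for j
    using degree_smult_le[of _ "P j"] by (simp add: f degP)
  show "degree (racah_poly \<alpha> \<beta> \<gamma> \<delta> k) \<le> k"
    unfolding racah_poly_def
    by (intro degree_sum_le order.trans[OF degree_smult_le]) (auto intro: order.trans[OF deg])
  have "coeff (racah_f \<gamma> \<delta> j) k = 0" if "j < k" for j
    using deg[of j] that by (intro coeff_eq_0) simp
  then have "coeff (racah_poly \<alpha> \<beta> \<gamma> \<delta> k) k = 1 / (-1) ^ k * coeff (racah_f \<gamma> \<delta> k) k"
    unfolding racah_poly_def coeff_sum
    by (subst sum.remove[of _ k]) (auto intro!: sum.neutral)
  then show "coeff (racah_poly \<alpha> \<beta> \<gamma> \<delta> k) k = 1 / fact k"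
    by (simp add: f lc)
qed

text \<open>Differences on the lattice factor as
  \<open>(k - i) * (2 * x + \<gamma> + \<delta> + 1 + k + i)\<close>; the first factors multiply to
  \<open>fact k\<close> and cancel the leading coefficient. The result is the denominator of
  \<open>racah_R\<close>.\<close>

lemma det_racah_poly_eval:
  "det (mat n n (\<lambda>(k, i). poly (racah_poly \<alpha> \<beta> \<gamma> \<delta> k) ((x + real i) * (x + real i + \<gamma> + \<delta> + 1))))
    = (\<Prod>l<n. pochhammer (2 * x + \<gamma> + \<delta> + 1 + real l) l)"
proof -
  define z where "z i = (x + real i) * (x + real i + \<gamma> + \<delta> + 1)" for i
  have "1 / fact k * (\<Prod>i<k. z k - z i) = pochhammer (2 * x + \<gamma> + \<delta> + 1 + real k) k" for k
  proof -
    have "(\<Prod>i<k. z k - z i) = (\<Prod>i<k. real (k - i) * (2 * x + \<gamma> + \<delta> + 1 + real k + real i))"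
      by (intro prod.cong refl) (simp add: z_def of_nat_diff algebra_simps)
    also have "\<dots> = fact k * pochhammer (2 * x + \<gamma> + \<delta> + 1 + real k) k"
      unfolding prod.distrib by (simp add: fact_prod_rev pochhammer_prod atLeast0LessThan)
    finally show ?thesis by simp
  qed
  then show ?thesis
    unfolding z_def[symmetric]
    by (simp add: det_poly_eval degree_racah_poly coeff_racah_poly flip: prod.distrib)
qed

section \<open>Reciprocity\<close>

text \<open>The reciprocity at a real point, kept free of denominators so that \<open>x\<close> is
  arbitrary. Determinants are compared in the product \<open>Q * P\<close>: \<open>det P\<close> is
  the full Vandermonde-type determinant, \<open>det Q\<close> carries the minor in \<open>q\<close>,
  and the product carries the minor in \<open>p\<close>.\<close>

lemma racah_det_reciprocity:
  fixes A B G D x :: real and n m d :: nat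
  assumes nz: "\<And>q. 2 \<le> q \<Longrightarrow> q \<le> 2 * d \<Longrightarrow> A + B + real q \<noteq> 0"
    and d: "n + m = Suc d"
  shows "det (mat n n (\<lambda>(i, j). poly (racah_poly A B G D (m + j))
              ((x + real i) * (x + real i + G + D + 1))))
         * (\<Prod>s<m. pochhammer (2 * x + G + D + 1 + real d - 2 * real s) d)
       = (\<Prod>j<m. (-1) ^ j)
         * det (mat m m (\<lambda>(s, j).
              poly (racah_poly (- A - real d - 1) (- B - real d - 1) (- G - real d - 1) (- D) (n + j))
              ((x - real s) * (x - real s + G + D + real d))))
         * (\<Prod>l<n + m. pochhammer (2 * x + G + D + 1 + real l) l)"
proof -
  define p where "p = racah_poly A B G D"
  define q where "q = racah_poly (- A - real d - 1) (- B - real d - 1) (- G - real d - 1) (- D)"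
  define z where "z i = (x + real i) * (x + real i + G + D + 1)" for i
  define Y where "Y s = (x - real s) * (x - real s + G + D + real d)" for s
  \<comment> \<open>Rows of \<open>P\<close> are in decreasing degree and the columns are ordered by \<open>\<iota>\<close>, so that the nonzero
    diagonal block of kernel values in \<open>Q * P\<close> is triangular rather than antitriangular.\<close>
  define \<iota> where "\<iota> b = (if b < n then n - 1 - b else d + n - b)" for b
  \<comment> \<open>The kernel at \<open>y = x - s\<close> and \<open>t = x + i\<close>.\<close>
  define K where "K s i = pochhammer (- (real s + real i)) d
      * pochhammer (2 * x - real s + real i + (G + D + 1)) d" for s i
  define L where "L = det (mat n n (\<lambda>(i, j). poly (p (m + j)) (z i)))"
  define R where "R = det (mat m m (\<lambda>(s, j). poly (q (n + j)) (Y s)))"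
  have kernel: "K s i = (\<Sum>j<n + m. fact d * (-1) ^ (d - j) * poly (q j) (Y s) * poly (p (d - j)) (z i))"
    for s i
  proof -
    have "K s i = pochhammer ((x - real s) - (x + real i)) d
        * pochhammer ((x - real s) + (x + real i) + (G + D + 1)) d"
      unfolding K_def by (simp add: algebra_simps)
    also have "\<dots> = fact d * (\<Sum>k\<le>d. (-1) ^ k * poly (p k) (z i) * poly (q (d - k)) (Y s))"
      unfolding p_def q_def Y_def z_def by (intro racah_kernel nz)
    also have "\<dots> = (\<Sum>k\<le>d. fact d * (-1) ^ k * poly (q (d - k)) (Y s) * poly (p k) (z i))"
      unfolding sum_distrib_left
      by (intro sum.cong refl) (simp only: mult_ac)
    also have "\<dots> = (\<Sum>j\<le>d. fact d * (-1) ^ (d - j) * poly (q j) (Y s) * poly (p (d - j)) (z i))"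
      by (rule sum.reindex_bij_witness[of _ "\<lambda>j. d - j" "\<lambda>k. d - k"]) auto
    also have "{..d} = {..<n + m}" using d by auto
    finally show ?thesis .
  qed
  have K0: "K s i = 0" if "s + i < d" for s i
    using pochhammer_of_nat_eq_0_lemma[OF that, where 'a = real] by (simp add: K_def)
  define P where "P = mat (n + m) (n + m) (\<lambda>(j, b). poly (p (d - j)) (z (\<iota> b)))"
  \<comment> \<open>The first \<open>n\<close> rows of \<open>Q\<close> copy the rows of
    \<open>P\<close> of degrees \<open>d\<close> down to \<open>m\<close>; the last \<open>m\<close>
    rows form kernel values.\<close>
  define Q where "Q = mat (n + m) (n + m) (\<lambda>(a, j). if a < n then (if a = j then 1 else 0)
      else fact d * (-1) ^ (d - j) * poly (q j) (Y (a - n)))"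
  define W where "W a b = (if a < n then poly (p (d - a)) (z (\<iota> b)) else K (a - n) (\<iota> b))" for a b
  have "Q * P = mat (n + m) (n + m) (\<lambda>(a, b). W a b)"
  proof (rule eq_matI)
    fix a b assume "a < dim_row (mat (n + m) (n + m) (\<lambda>(a, b). W a b))"
      "b < dim_col (mat (n + m) (n + m) (\<lambda>(a, b). W a b))"
    then have ab: "a < n + m" "b < n + m" by auto
    then have "(Q * P) $$ (a, b) = (\<Sum>j<n + m. (if a < n then (if a = j then 1 else 0)
      else fact d * (-1) ^ (d - j) * poly (q j) (Y (a - n))) * poly (p (d - j)) (z (\<iota> b)))"
      by (simp add: Q_def P_def scalar_prod_def atLeast0LessThan)
    also have "\<dots> = W a b"
    proof (cases "a < n")
      case True
      then show ?thesis
        by (simp add: W_def if_distrib[of "\<lambda>u. u * _"] sum.delta cong: if_cong)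
    next
      case False
      then show ?thesis by (simp add: W_def kernel)
    qed
    finally show "(Q * P) $$ (a, b) = mat (n + m) (n + m) (\<lambda>(a, b). W a b) $$ (a, b)"
      using ab by simp
  qed (simp_all add: Q_def P_def)
  then have QP: "det Q * det P = det (mat (n + m) (n + m) (\<lambda>(a, b). W a b))"
    using det_mult[of Q "n + m" P] by (simp add: Q_def P_def)

  \<comment> \<open>Columns \<open>b < n\<close> carry the points \<open>x + i\<close> with
    \<open>i < n\<close>, and lower rows have \<open>s < m\<close>. Hence
    \<open>s + i \<le> n + m - 2 < d\<close>, and that block vanishes.\<close>
  have "det (mat (n + m) (n + m) (\<lambda>(a, b). W a b))
      = det (mat n n (\<lambda>(a, b). W a b)) * det (mat m m (\<lambda>(a, b). W (n + a) (n + b)))"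
  proof (rule det_mat_lower_left_zero)
    fix i j assume "n \<le> i" "i < n + m" "j < n"
    then show "W i j = 0" using d by (auto simp: W_def \<iota>_def intro!: K0)
  qed
  moreover have "det (mat n n (\<lambda>(a, b). W a b)) = L"
  proof -
    have "mat n n (\<lambda>(a, b). W a b) = mat n n (\<lambda>(a, b). poly (p (m + (n - 1 - a))) (z (n - 1 - b)))"
    proof (rule eq_matI)
      fix a b assume "a < dim_row (mat n n (\<lambda>(a, b). poly (p (m + (n - 1 - a))) (z (n - 1 - b))))"
        "b < dim_col (mat n n (\<lambda>(a, b). poly (p (m + (n - 1 - a))) (z (n - 1 - b))))"
      moreover from this have "d - a = m + (n - 1 - a)" using d by auto
      ultimately show "mat n n (\<lambda>(a, b). W a b) $$ (a, b)
          = mat n n (\<lambda>(a, b). poly (p (m + (n - 1 - a))) (z (n - 1 - b))) $$ (a, b)"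
        by (simp add: W_def \<iota>_def)
    qed auto
    then have "det (mat n n (\<lambda>(a, b). W a b)) = det (mat n n (\<lambda>(a, b). poly (p (m + a)) (z b)))"
      using det_reverse[of n "\<lambda>a b. poly (p (m + a)) (z b)"] by simp
    also have "mat n n (\<lambda>(a, b). poly (p (m + a)) (z b))
        = transpose_mat (mat n n (\<lambda>(i, j). poly (p (m + j)) (z i)))"
      by (rule eq_matI) auto
    also have "det \<dots> = L" unfolding L_def by (rule det_transpose[of _ n]) simp
    finally show ?thesis .
  qed
  moreover have "det (mat m m (\<lambda>(a, b). W (n + a) (n + b)))
      = ((-1) ^ d * fact d) ^ m * (\<Prod>s<m. pochhammer (2 * x + G + D + 1 + real d - 2 * real s) d)"
  proof -
    \<comment> \<open>Column \<open>n + b\<close> carries the point \<open>x + (d - b)\<close>, so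
      row \<open>a\<close> vanishes there as soon as \<open>a < b\<close>.\<close>
    define T where "T = mat m m (\<lambda>(a, b). W (n + a) (n + b))"
    have "det T = prod_list (diag_mat T)"
    proof (rule det_lower_triangular[where n = m])
      fix a b assume "a < b" "b < m"
      then show "T $$ (a, b) = 0" using d by (auto simp: T_def W_def \<iota>_def intro!: K0)
    qed (simp add: T_def)
    also have "\<dots> = (\<Prod>s<m. K s (d - s))"
      by (auto simp: prod_list_diag_prod T_def atLeast0LessThan W_def \<iota>_def intro!: prod.cong)
    also have "\<dots> = (\<Prod>s<m. (-1) ^ d * fact d * pochhammer (2 * x + G + D + 1 + real d - 2 * real s) d)"
    proof (intro prod.cong refl)
      fix s assume "s \<in> {..<m}"
      then have s: "real (d - s) = real d - real s" using d by (simp add: of_nat_diff)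
      have "pochhammer (- real d) d = (-1) ^ d * fact d"
        using pochhammer_same[of d, where 'a = real] by simp
      then show "K s (d - s) = (-1) ^ d * fact d
          * pochhammer (2 * x + G + D + 1 + real d - 2 * real s) d"
        by (simp add: K_def s algebra_simps)
    qed
    finally show ?thesis by (simp add: T_def prod.distrib)
  qed
  moreover have "det Q = fact d ^ m * (\<Prod>j<m. (-1) ^ j) * R"
  proof -
    have "det Q = det (mat n n (\<lambda>(a, j). if a < n then (if a = j then 1 else 0)
            else fact d * (-1) ^ (d - j) * poly (q j) (Y (a - n))))
        * det (mat m m (\<lambda>(a, j). if n + a < n then (if n + a = n + j then 1 else 0)
            else fact d * (-1) ^ (d - (n + j)) * poly (q (n + j)) (Y (n + a - n))))"
      unfolding Q_def by (rule det_mat_upper_right_zero) simp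
    also have "mat n n (\<lambda>(a, j). if a < n then (if a = j then 1 else 0)
            else fact d * (-1) ^ (d - j) * poly (q j) (Y (a - n))) = 1\<^sub>m n"
      by (rule eq_matI) auto
    also have "det (mat m m (\<lambda>(a, j). if n + a < n then (if n + a = n + j then 1 else 0)
            else fact d * (-1) ^ (d - (n + j)) * poly (q (n + j)) (Y (n + a - n))))
        = (\<Prod>j<m. fact d * (-1) ^ (d - (n + j))) * R"
      using det_scale_cols[of m "\<lambda>j. fact d * (-1) ^ (d - (n + j))" "\<lambda>s j. poly (q (n + j)) (Y s)"]
      by (simp add: R_def)
    also have "(\<Prod>j<m. fact d * (-1) ^ (d - (n + j))) = fact d ^ m * (\<Prod>j<m. (-1::real) ^ (m - Suc j))"
    proof -
      have "d - (n + j) = m - Suc j" for j using d by auto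
      then show ?thesis by (simp add: prod.distrib)
    qed
    also have "(\<Prod>j<m. (-1::real) ^ (m - Suc j)) = (\<Prod>j<m. (-1) ^ j)"
      by (rule prod.nat_diff_reindex)
    finally show ?thesis by simp
  qed
  moreover have "det P = (-1) ^ (m * n) * (\<Prod>l<n + m. pochhammer (2 * x + G + D + 1 + real l) l)"
  proof -
    define V where "V = mat (m + n) (m + n) (\<lambda>(k, i). poly (p k) (z i))"
    \<comment> \<open>The order \<iota> is a swap of the column blocks of sizes \<open>n\<close> and
      \<open>m\<close> followed by reversal. The swap costs \<open>(-1) ^ (m * n)\<close>; reversing
      rows and columns together costs nothing.\<close>
    define V' where "V' = mat (m + n) (m + n) (\<lambda>(k, i). V $$ (k, if i < m then i + n else i - m))"
    have "P = mat (n + m) (n + m) (\<lambda>(j, b). V' $$ (n + m - 1 - j, n + m - 1 - b))"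
      using d by (intro eq_matI)
        (auto simp: P_def V'_def V_def \<iota>_def intro!: arg_cong2[of _ _ _ _ "\<lambda>k i. poly (p k) (z i)"])
    then have "det P = det (mat (n + m) (n + m) (\<lambda>(k, i). V' $$ (k, i)))"
      using det_reverse[of "n + m" "\<lambda>k i. V' $$ (k, i)"] by simp
    also have "mat (n + m) (n + m) (\<lambda>(k, i). V' $$ (k, i)) = V'"
      by (rule eq_matI) (auto simp: V'_def)
    finally have "det P = det V'" .
    moreover have "det V = (-1) ^ (m * n) * det V'"
      unfolding V'_def by (rule det_swap_cols) (simp add: V_def)
    moreover have "det V = (\<Prod>l<n + m. pochhammer (2 * x + G + D + 1 + real l) l)"
      unfolding V_def p_def z_def add.commute[of m n] by (rule det_racah_poly_eval)
    ultimately show ?thesis by (cases "even (m * n)") simp_all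
  qed
  moreover have "((-1::real) ^ d) ^ m = (-1) ^ (m * n)"
  proof -
    \<comment> \<open>For odd \<open>m\<close>, \<open>n + m = Suc d\<close> gives \<open>d\<close>
      and \<open>n\<close> the same parity. So the sign of the triangular kernel block cancels that
      of \<open>det P\<close>.\<close>
    have "even (d * m) = even (m * n)"
    proof (cases "even m")
      case False
      have "even (Suc d) = even (n + m)" by (simp only: d)
      then show ?thesis using False by auto
    qed auto
    then show ?thesis by (auto simp: power_mult[symmetric] minus_one_power_iff)
  qed
  ultimately have "L * (\<Prod>s<m. pochhammer (2 * x + G + D + 1 + real d - 2 * real s) d)
      = (\<Prod>j<m. (-1) ^ j) * R * (\<Prod>l<n + m. pochhammer (2 * x + G + D + 1 + real l) l)"
    using QP by (cases "even (m * n)") (simp_all add: power_mult_distrib)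
  then show ?thesis unfolding L_def R_def p_def q_def z_def Y_def .
qed

section \<open>From real points to rational functions\<close>

lemma racah_well_definedD:
  assumes "racah_well_defined \<alpha> \<beta> k" "k < q" "q \<le> 2 * k"
  shows "\<alpha> + \<beta> + real q \<noteq> 0"
proof -
  \<comment> \<open>The denominator at \<open>j = 0\<close> contains every factor
    \<open>\<alpha> + \<beta> + q\<close> with \<open>k < q \<le> 2 * k\<close>.\<close>
  have "pochhammer (real k + \<alpha> + \<beta> + 1) k \<noteq> 0"
    using assms(1) by (auto simp: racah_well_defined_def dest: spec[of _ 0])
  moreover have "q - k - 1 < k" using assms(2,3) by simp
  ultimately have "real k + \<alpha> + \<beta> + 1 \<noteq> - real (q - k - 1)"
    unfolding pochhammer_eq_0_iff by blast
  moreover have "real (q - k - 1) = real q - real k - 1" using assms(2) by linarith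
  ultimately show ?thesis by simp
qed

lemma poly_det:
  "poly (det A) x = det (map_mat (\<lambda>p. poly p x) A)" for x :: "'a::comm_ring_1"
proof -
  interpret comm_ring_hom "\<lambda>p. poly p x" by unfold_locales auto
  show ?thesis by simp
qed

lemma poly_pochhammer: "poly (pochhammer p n) x = pochhammer (poly p x) n" for x :: "'a::comm_ring_1"
  by (induction n) (simp_all add: pochhammer_Suc)

lemma pochhammer_poly_nonzero:
  fixes p :: "'a::idom poly"
  assumes "degree p > 0"
  shows "pochhammer p n \<noteq> 0"
proof (induction n)
  case (Suc n)
  have "degree (p + of_nat n) = degree p" using assms by (intro degree_add_eq_left) simp
  then have "p + of_nat n \<noteq> 0" using assms by auto
  then show ?case using Suc by (simp add: pochhammer_Suc)
qed simp

theorem corollary5p9: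
  fixes n m :: nat and \<alpha> \<beta> \<gamma> \<delta> :: real
  assumes "\<And>k. m \<le> k \<Longrightarrow> k < m + n \<Longrightarrow>
      racah_well_defined (\<alpha> - real n - real m) (\<beta> - real n - real m) k"
    and "\<And>k. n \<le> k \<Longrightarrow> k < n + m \<Longrightarrow> racah_well_defined (- \<alpha>) (- \<beta>) k"
  shows "racah_R (\<alpha> - real n - real m) (\<beta> - real n - real m) (\<gamma> - real n - real m) \<delta> n m [:0, 1:]
       = racah_R (- \<alpha>) (- \<beta>) (- \<gamma>) (- \<delta>) m n (- [:0, 1:])"
proof (cases "n + m")
  case 0
  then show ?thesis by (simp add: racah_R_def)
next
  case (Suc d)
  define A where "A = \<alpha> - real n - real m"
  define B where "B = \<beta> - real n - real m"
  define G where "G = \<gamma> - real n - real m"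
  have d: "real d = real n + real m - 1" using Suc by linarith
  have dual: "- A - real d - 1 = - \<alpha>" "- B - real d - 1 = - \<beta>" "- G - real d - 1 = - \<gamma>"
    by (simp_all add: A_def B_def G_def d)
  \<comment> \<open>The two families share the range, split at \<open>q = n + 2 * m\<close>. From
    there on some degree \<open>k\<close> of the first family has \<open>k < q \<le> 2 * k\<close>.
    Below it, \<open>A + B + q\<close> is the negative of \<open>- \<alpha> - \<beta> + r\<close>
    with \<open>r = 2 * (n + m) - q > n\<close>, which the second family covers. For
    \<open>m = 0\<close> the first family covers everything.\<close>
  have nz: "A + B + real q \<noteq> 0" if q: "2 \<le> q" "q \<le> 2 * d" for q
  proof (cases "m = 0 \<or> 2 * (n + m) \<le> n + q")
    case True
    define k where "k = max m ((q + 1) div 2)"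
    have "m \<le> k" "k < m + n" "k < q" "q \<le> 2 * k"
      using True q Suc by (auto simp: k_def)
    then show ?thesis
      using racah_well_definedD[OF assms(1)] by (simp add: A_def B_def)
  next
    case False
    define r where "r = 2 * (n + m) - q"
    define k where "k = max n ((r + 1) div 2)"
    have "n \<le> k" "k < n + m" "k < r" "r \<le> 2 * k"
      using False q Suc by (auto simp: k_def r_def)
    then have "- \<alpha> + - \<beta> + real r \<noteq> 0"
      using racah_well_definedD[OF assms(2)] by blast
    moreover have "real r = 2 * (real n + real m) - real q"
      using q Suc by (simp add: r_def of_nat_diff)
    ultimately show ?thesis by (simp add: A_def B_def)
  qed
  define L where "L = det (mat n n (\<lambda>(i, j). pcompose (racah_poly A B G \<delta> (m + j))
      (racah_lambda G \<delta> ([:0, 1:] + of_nat i))))"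
  define R where "R = det (mat m m (\<lambda>(i, j). pcompose (racah_poly (- \<alpha>) (- \<beta>) (- \<gamma>) (- \<delta>) (n + j))
      (racah_lambda (- \<gamma>) (- \<delta>) (- [:0, 1:] + of_nat i))))"
  define DL where "DL = (\<Prod>l = 1..<n. pochhammer (2 * [:0, 1:] + [:G + \<delta> + 1 + real l:]) l)"
  define DR where "DR = (\<Prod>l = 1..<m. pochhammer (2 * - [:0, 1:] + [:- \<gamma> + - \<delta> + 1 + real l:]) l)"
  \<comment> \<open>\<open>W\<close> is the factor common to both products in
    \<open>racah_det_reciprocity\<close>: the part \<open>l \<ge> n\<close> of the Vandermonde-type
    product, and the last \<open>d - s\<close> factors of each diagonal kernel value.\<close>
  define W where "W = (\<Prod>s<m. pochhammer [:\<gamma> + \<delta> - real s, 2:] (d - s))"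
  have "W \<noteq> 0" unfolding W_def by (simp add: pochhammer_poly_nonzero)
  have "DL \<noteq> 0" unfolding DL_def by (simp add: pochhammer_poly_nonzero numeral_poly)
  have "DR \<noteq> 0" unfolding DR_def by (simp add: pochhammer_poly_nonzero numeral_poly)
  \<comment> \<open>The cross-multiplied identity is proved at every real \<open>x\<close>,
    including zeros of \<open>W\<close>; only afterwards is \<open>W\<close> cancelled in the
    polynomial ring.\<close>
  have "poly (L * DR * W) x = poly (R * DL * W) x" for x
  proof -
    define z where "z = 2 * x + \<gamma> + \<delta>"
    define a where "a s = pochhammer (z - 2 * real s) s" for s
    define w where "w s = pochhammer (z - real s) (d - s)" for s
    define S where "S = (\<Prod>j<m. (-1::real) ^ j)"
    \<comment> \<open>The denominators start at \<open>l = 1\<close>; the index 0 adds an empty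
      Pochhammer symbol.\<close>
    have from1: "prod h {1..<k} = prod h {..<k}" if "h 0 = 1" for h :: "nat \<Rightarrow> real" and k
      using that by (intro prod.mono_neutral_left) (auto simp: not_less_eq_eq)
    have L: "poly L x = det (mat n n (\<lambda>(i, j). poly (racah_poly A B G \<delta> (m + j))
              ((x + real i) * (x + real i + G + \<delta> + 1))))"
      unfolding L_def poly_det
      by (intro arg_cong[where f = det] eq_matI) (auto simp: poly_pcompose racah_lambda_def add_ac)
    have R: "poly R x = det (mat m m (\<lambda>(s, j).
              poly (racah_poly (- A - real d - 1) (- B - real d - 1) (- G - real d - 1) (- \<delta>) (n + j))
              ((x - real s) * (x - real s + G + \<delta> + real d))))"
    proof -
      have "(- x + real s) * (- x + real s + (- \<gamma> - \<delta> + 1))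
          = (x - real s) * (x - real s + G + \<delta> + real d)" for s
        by (simp add: G_def d algebra_simps)
      then show ?thesis
        unfolding R_def poly_det dual
        by (intro arg_cong[where f = det] eq_matI) (auto simp: poly_pcompose racah_lambda_def)
    qed
    have DL: "poly DL x = (\<Prod>l<n. pochhammer (2 * x + G + \<delta> + 1 + real l) l)"
      unfolding DL_def poly_prod poly_pochhammer by (subst from1) (simp_all add: algebra_simps)
    \<comment> \<open>Reflection at \<open>- x\<close> produces the sign \<open>S\<close>, the same
      as the column sign in \<open>racah_det_reciprocity\<close>; together they give
      \<open>S * S = 1\<close>.\<close>
    have DR: "poly DR x = S * (\<Prod>s<m. a s)"
    proof -
      have "pochhammer (- 2 * x + (- \<gamma> + - \<delta> + 1 + real s)) s = (-1) ^ s * a s" for s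
        unfolding a_def by (rule pochhammer_reflect) (simp add: z_def)
      then show ?thesis
        unfolding DR_def poly_prod poly_pochhammer S_def prod.distrib[symmetric]
        by (subst from1) (simp_all add: mult.commute[of x])
    qed
    have W: "poly W x = (\<Prod>s<m. w s)"
      by (simp add: W_def poly_prod poly_pochhammer w_def z_def algebra_simps)
    have split: "(\<Prod>s<m. pochhammer (2 * x + G + \<delta> + 1 + real d - 2 * real s) d)
        = (\<Prod>s<m. a s) * (\<Prod>s<m. w s)"
      unfolding prod.distrib[symmetric]
    proof (intro prod.cong refl)
      fix s assume "s \<in> {..<m}"
      then have "s \<le> d" using Suc by simp
      then show "pochhammer (2 * x + G + \<delta> + 1 + real d - 2 * real s) d = a s * w s"
        using pochhammer_product[of s d "z - 2 * real s"]
        by (simp add: a_def w_def z_def G_def d algebra_simps)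
    qed
    have "(\<Prod>l<n + m. pochhammer (2 * x + G + \<delta> + 1 + real l) l)
        = poly DL x * (\<Prod>l\<in>{n..<n + m}. pochhammer (2 * x + G + \<delta> + 1 + real l) l)"
      unfolding DL by (subst prod.union_disjoint[symmetric]) (auto intro!: prod.cong)
    also have "(\<Prod>l\<in>{n..<n + m}. pochhammer (2 * x + G + \<delta> + 1 + real l) l) = (\<Prod>s<m. w s)"
    proof (rule prod.reindex_bij_witness[of _ "\<lambda>s. d - s" "\<lambda>l. d - l"])
      fix l assume "l \<in> {n..<n + m}"
      then have "real (d - l) = real d - real l" "d - (d - l) = l" using Suc by auto
      then show "w (d - l) = pochhammer (2 * x + G + \<delta> + 1 + real l) l"
        by (simp add: w_def z_def G_def d algebra_simps)
    qed (use Suc in auto)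
    finally have upto: "(\<Prod>l<n + m. pochhammer (2 * x + G + \<delta> + 1 + real l) l)
        = poly DL x * (\<Prod>s<m. w s)" .
    have key: "poly L x * ((\<Prod>s<m. a s) * (\<Prod>s<m. w s)) = S * poly R x * (poly DL x * (\<Prod>s<m. w s))"
      unfolding L R S_def split[symmetric] upto[symmetric] by (rule racah_det_reciprocity[OF nz Suc])
    have "S * S = 1"
      unfolding S_def prod.distrib[symmetric] by (simp flip: power_mult_distrib)
    have "poly (L * DR * W) x = S * (poly L x * ((\<Prod>s<m. a s) * (\<Prod>s<m. w s)))"
      unfolding poly_mult DR W by (simp only: mult_ac)
    also have "\<dots> = (S * S) * (poly R x * poly DL x * (\<Prod>s<m. w s))"
      unfolding key by (simp only: mult_ac)
    finally show ?thesis using \<open>S * S = 1\<close> by (simp add: W)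
  qed
  then have "L * DR * W = R * DL * W" by (simp only: poly_eq_poly_eq_iff[symmetric] fun_eq_iff) simp
  with \<open>W \<noteq> 0\<close> have "L * DR = R * DL" by simp
  with \<open>DL \<noteq> 0\<close> \<open>DR \<noteq> 0\<close> have "Fract L DL = Fract R DR" by (simp add: eq_fract)
  then show ?thesis
    by (simp only: racah_R_def L_def R_def DL_def DR_def A_def B_def G_def)
qed

end
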